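(* Let $X$ be an (integrable, real-valued) random variable, $\alpha\in(0,1]$, $\delta\in(0,0.5)$, and $\epsilon=\sqrt{\ln(1/\delta)/(2n)}$. Let $X_1,\dots,X_n$ be i.i.d. random variables with CDF $F_X$, and let $\hat F_X$ be the empirical CDF they define. (1) Upper bound. If $P(X\le b)=1$, then: (a) if $\alpha>\epsilon$, then $P\big(\mathrm{CVaR}_\alpha(X)\le(1-\frac{\epsilon}{\alpha})C_{\alpha-\epsilon}^{\hat F_X}+\frac{\epsilon}{\alpha}b\big)>1-\delta$; (b) if $\alpha\le\epsilon$, then $\mathrm{CVaR}_\alpha(X)\le b$. (2) Lower bound. If $P(X\ge a)=1$, then: (a) if $\alpha+\epsilon<1$, then $P\big(\mathrm{CVaR}_\alpha(X)\ge(1+\frac{\epsilon}{\alpha})C_{\alpha+\epsilon}^{\hat F_X}-\frac{\epsilon}{\alpha}C_\epsilon^{\hat F_X}\big)>1-\delta$; (b) if $\alpha+\epsilon\ge1$, then $P\big(\mathrm{CVaR}_\alpha(X)\ge\frac1\alpha[(\alpha+\epsilon-1)a+\mathbb{E}_{\hat F_X}[X]-\epsilon\,C_\epsilon^{\hat F_X}]\big)>1-\delta$.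
   Context: $X$ has finite first absolute moment; $n\ge1$ is the number of samples; $a,b$ are real numbers. $F_X(x)=P(X\le x)$ and $\hat F_X(x)=\frac1n\sum_{i=1}^n 1_{X_i\le x}$. $\mathrm{CVaR}_\alpha(X)=\inf_{w\in\mathbb{R}}\{w+\frac1\alpha\mathbb{E}[(X-w)^+]\}$, with $(x)^+=\max(x,0)$. $C_\beta^{\hat F_X}$ denotes the CVaR at level $\beta$ computed under the empirical distribution $\hat F_X$, i.e. $C_\beta^{\hat F_X}=\inf_{w\in\mathbb{R}}\{w+\frac1{n\beta}\sum_{i=1}^n(X_i-w)^+\}$, and $\mathbb{E}_{\hat F_X}[X]=\frac1n\sum_{i=1}^nX_i$ is the expectation under $\hat F_X$.
   Formalization: In (2)(b) the condition ε ≤ 1 is added: for ε > 1 the infimum defining the empirical CVaR at level ε is −∞, so the stated lower bound would be +∞ and the claim false. *)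

theory Defs
  imports "HOL-Probability.Probability"
begin

text \<open>
  For \<open>X\<close> integrable and \<open>0 < \<alpha> \<le> 1\<close> the infimum is over a set bounded below by the mean of \<open>X\<close>
  (lemma \<open>CVaR_objective_ge\<close>), so the real-valued \<open>INF\<close> is the mathematical infimum.
  For levels above 1 the objective is unbounded below (lemma \<open>emp_CVaR_objective_unbounded\<close> for
  samples) and the value of \<open>INF\<close> is meaningless.
\<close>

definition CVaR :: "'a measure \<Rightarrow> real \<Rightarrow> ('a \<Rightarrow> real) \<Rightarrow> real" where
  "CVaR M \<alpha> X = (INF w::real. w + 1 / \<alpha> * (\<integral>\<omega>. max (X \<omega> - w) 0 \<partial>M))"

text \<open>A sample \<open>x 1, \<dots>, x n\<close> is a function on \<^typ>\<open>nat\<close> of which only the values on \<open>{1..n}\<close> matter.\<close>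

definition emp_cdf :: "nat \<Rightarrow> (nat \<Rightarrow> real) \<Rightarrow> real \<Rightarrow> real" where
  "emp_cdf n x t = 1 / real n * (\<Sum>i=1..n. if x i \<le> t then 1 else 0)"

definition emp_mean :: "nat \<Rightarrow> (nat \<Rightarrow> real) \<Rightarrow> real" where
  "emp_mean n x = 1 / real n * (\<Sum>i=1..n. x i)"

definition emp_CVaR :: "nat \<Rightarrow> (nat \<Rightarrow> real) \<Rightarrow> real \<Rightarrow> real" where
  "emp_CVaR n x \<beta> = (INF w::real. w + 1 / (real n * \<beta>) * (\<Sum>i=1..n. max (x i - w) 0))"

lemma (in prob_space) CVaR_objective_ge:
  fixes X :: "'a \<Rightarrow> real"
  assumes X: "integrable M X" and "0 < \<alpha>" "\<alpha> \<le> 1"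
  shows "expectation X \<le> w + 1 / \<alpha> * (\<integral>\<omega>. max (X \<omega> - w) 0 \<partial>M)"
proof -
  let ?I = "\<integral>\<omega>. max (X \<omega> - w) 0 \<partial>M"
  have "expectation X - w = (\<integral>\<omega>. X \<omega> - w \<partial>M)"
    using X by (simp add: prob_space)
  also have "\<dots> \<le> ?I"
    by (intro integral_mono) (use X in auto)
  finally have "expectation X - w \<le> ?I" .
  moreover have "0 \<le> ?I"
    by (intro integral_nonneg_AE) auto
  then have "1 * ?I \<le> 1 / \<alpha> * ?I"
    by (intro mult_right_mono) (use assms in auto)
  ultimately show ?thesis by simp
qed

text \<open>
  The explicit formulas are the mean and the CVaR under the (unique) distribution whose CDF is
  the empirical CDF.
\<close>

lemma emp_distribution_unique:
  assumes "n \<ge> 1" "real_distribution N" "cdf N = emp_cdf n x"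
  shows "N = distr (measure_pmf (pmf_of_set {1..n})) borel x"
proof -
  let ?U = "measure_pmf (pmf_of_set {1..n})"
  let ?D = "distr ?U borel x"
  have ne: "{1..n} \<noteq> {}" "finite {1..n}" using assms(1) by auto
  have D: "real_distribution ?D"
    by (simp add: prob_space.prob_space_distr measure_pmf.prob_space_axioms
        real_distribution_def real_distribution_axioms_def)
  have "cdf ?D t = emp_cdf n x t" for t
  proof -
    have "cdf ?D t = measure ?U {i. x i \<le> t}"
      by (simp add: cdf_def measure_distr vimage_def)
    also have "\<dots> = real (card ({1..n} \<inter> {i. x i \<le> t})) / real n"
      using ne by (subst measure_pmf_of_set) auto
    also have "\<dots> = emp_cdf n x t"
      by (simp add: emp_cdf_def sum.If_cases)
    finally show ?thesis .
  qed
  with assms(3) have "cdf N = cdf ?D" by auto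
  with assms(2) D show ?thesis by (rule cdf_unique)
qed

lemma emp_mean_eq:
  assumes "n \<ge> 1" "real_distribution N" "cdf N = emp_cdf n x"
  shows "emp_mean n x = (\<integral>t. t \<partial>N)"
proof -
  have "{1..n} \<noteq> {}" using assms(1) by auto
  then show ?thesis
    unfolding emp_distribution_unique[OF assms] emp_mean_def
    by (simp add: integral_distr integral_pmf_of_set)
qed

lemma emp_CVaR_eq:
  assumes "n \<ge> 1" "real_distribution N" "cdf N = emp_cdf n x"
  shows "emp_CVaR n x \<beta> = CVaR N \<beta> (\<lambda>t. t)"
proof -
  have "{1..n} \<noteq> {}" using assms(1) by auto
  then show ?thesis
    unfolding emp_distribution_unique[OF assms] emp_CVaR_def CVaR_def
    by (simp add: integral_distr integral_pmf_of_set mult.commute)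
qed

lemma emp_CVaR_objective_unbounded:
  assumes "n \<ge> 1" "\<beta> > 1"
  shows "\<not> bdd_below (range (\<lambda>w. w + 1 / (real n * \<beta>) * (\<Sum>i=1..n. max (x i - w) 0)))"
proof
  let ?f = "\<lambda>w. w + 1 / (real n * \<beta>) * (\<Sum>i=1..n. max (x i - w) 0)"
  assume "bdd_below (range ?f)"
  then obtain K where K: "\<And>w. K \<le> ?f w" by (auto simp: bdd_below_def)
  define m where "m = Min (x ` {1..n})"
  define S where "S = (\<Sum>i=1..n. x i)"
  define c where "c = (K - S / (real n * \<beta>)) / (1 - 1 / \<beta>)"
  define w where "w = min m (c - 1)"
  have m: "m \<le> x i" if "i \<in> {1..n}" for i
    using that by (auto simp: m_def)
  have "(\<Sum>i=1..n. max (x i - w) 0) = (\<Sum>i=1..n. x i - w)"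
    by (intro sum.cong) (use m in \<open>fastforce simp: w_def max_def\<close>)+
  also have "\<dots> = S - real n * w"
    by (simp add: sum_subtractf S_def)
  finally have "?f w = w * (1 - 1 / \<beta>) + S / (real n * \<beta>)"
    using assms by (simp add: field_simps)
  also have "w * (1 - 1 / \<beta>) < c * (1 - 1 / \<beta>)"
    using assms by (intro mult_strict_right_mono) (auto simp: w_def)
  also have "c * (1 - 1 / \<beta>) = K - S / (real n * \<beta>)"
    using assms by (simp add: c_def)
  finally show False using K[of w] by simp
qed

end

theory Submission
  imports Defs
begin

text \<open>
  The probability bounds rest on a strict one-sided DKW inequality with Massart's constant.  For
  fixed \<open>w > 0\<close> the products \<open>Y q = (1 + w / P(X > q)) ^ #{i. X\<^sub>i > q}\<close> form a martingale in \<open>q\<close>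
  (the past at \<open>q\<close> being the truncated sample \<open>min X\<^sub>i q\<close>) with mean \<open>(1 + w) ^ n\<close>, so a single
  application of Doob's maximal inequality controls all \<open>q\<close> at once.  A saddle point argument
  provides a \<open>w\<close> that makes this loss-free: with \<open>s\<close> minimising the relative entropy
  \<open>kl(t + \<epsilon>, t)\<close> and \<open>w\<close> the optimal Chernoff tilt for \<open>s\<close>, the exponent
  \<open>(t + \<epsilon>) ln (1 + w / t) - ln (1 + w)\<close> is smallest at \<open>t = s\<close>, where it equals
  \<open>kl(s + \<epsilon>, s) > 2 \<epsilon>\<^sup>2\<close>.  Given the DKW event, \<open>E[(X - w)\<^sup>+ - (X - v)\<^sup>+]\<close> is the integral of the
  tail over \<open>[w, v]\<close>, so it differs from its empirical counterpart by at most \<open>\<epsilon> (v - w)\<close> on the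
  relevant side; the CVaR bounds follow by comparing the objectives pointwise in \<open>w\<close>.
\<close>

section \<open>The exponent\<close>

lemma convex_on_bernoulli: "convex_on {0<..} (\<lambda>m::real. m / (exp m - 1))"
proof (rule f''_ge0_imp_convex)
  let ?f' = "\<lambda>m::real. (exp m - 1 - m * exp m) / (exp m - 1)^2"
  let ?f'' = "\<lambda>m::real. exp m * (m * (exp m + 1) - 2 * (exp m - 1)) / (exp m - 1)^3"
  show "convex {0::real<..}" by simp
  fix m :: real assume m: "m \<in> {0<..}"
  then have ne: "exp m - 1 \<noteq> 0" by simp
  show "((\<lambda>m. m / (exp m - 1)) has_field_derivative ?f' m) (at m)"
    using ne by (auto intro!: derivative_eq_intros simp: power2_eq_square)
  show "(?f' has_field_derivative ?f'' m) (at m)"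
    using ne by (auto intro!: derivative_eq_intros simp: divide_simps) algebra
  \<comment> \<open>The sign of the second derivative comes down to tanh (m / 2) \<le> m / 2. The
    gap \<open>?g\<close> vanishes at 0 and is nondecreasing because
    \<open>1 - x \<le> exp (- x)\<close>.\<close>
  have "2 * (exp m - 1) \<le> m * (exp m + 1)"
  proof -
    let ?g = "\<lambda>m::real. m * (exp m + 1) - 2 * (exp m - 1)"
    have "?g 0 \<le> ?g m"
    proof (rule DERIV_nonneg_imp_nondecreasing[of 0 m])
      show "0 \<le> m" using m by simp
      fix x :: real assume x: "0 \<le> x" 
      have "(?g has_real_derivative (exp x * (exp (- x) - (1 + - x)))) (at x)"
        by (auto intro!: derivative_eq_intros simp: algebra_simps simp flip: exp_add)
      moreover have "0 \<le> exp x * (exp (- x) - (1 + - x))"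
        using exp_ge_add_one_self[of "-x"] by (intro mult_nonneg_nonneg) auto
      ultimately show "\<exists>y. (?g has_real_derivative y) (at x) \<and> 0 \<le> y" by blast
    qed
    then show ?thesis by simp
  qed
  moreover have "exp m - 1 > 0" using m by simp
  ultimately show "?f'' m \<ge> 0" by (intro divide_nonneg_nonneg mult_nonneg_nonneg) auto
qed

text \<open>Pinsker's inequality for Bernoulli laws, in strict form. For fixed p, the gap between
  the two sides as a function of x in place of q vanishes at x = p and has derivative - (p - x) (1 -
  2 x)^2 / (x (1 - x)), negative below p except at 1/2.\<close>

lemma binary_kl_gt:
  fixes p q :: real
  assumes "0 < q" "q < p" "p < 1"
  shows "2 * (p - q)^2 < p * ln (p / q) + (1 - p) * ln ((1 - p) / (1 - q))"
proof -
  define k where "k = (\<lambda>x. p * (ln p - ln x) + (1 - p) * (ln (1 - p) - ln (1 - x)) - 2 * (p - x)^2)"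
  have deriv: "\<exists>y. (k has_real_derivative y) (at x) \<and> y < 0"
    if x: "0 < x" "x < p" "x \<noteq> 1 / 2" for x
  proof (intro exI conjI)
    have x1: "x < 1" using x assms by simp
    show "(k has_real_derivative - p / x + (1 - p) / (1 - x) + 4 * (p - x)) (at x)"
      unfolding k_def using x(1,2) x1 by (auto intro!: derivative_eq_intros)
    have "- p / x + (1 - p) / (1 - x) + 4 * (p - x) = - ((p - x) * (1 - 2 * x)^2 / (x * (1 - x)))"
      using x x1 by (simp add: divide_simps) algebra
    also have "\<dots> < 0"
      using x x1 by simp
    finally show "- p / x + (1 - p) / (1 - x) + 4 * (p - x) < 0" .
  qed
  have cont: "continuous_on {a..b} k" if "0 < a" "b \<le> p" for a b
    unfolding k_def using that assms by (intro continuous_intros) auto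
  \<comment> \<open>The derivative vanishes at 1/2, so strict decrease is first obtained on
    intervals without 1/2 in their interior; an interval across 1/2 is cut there.\<close>
  have dec: "k b < k a" if "0 < a" "a < b" "b \<le> p" "b \<le> 1/2 \<or> 1/2 \<le> a" for a b
    by (rule DERIV_neg_imp_decreasing_open) (use that in \<open>auto intro!: deriv cont\<close>)
  have "k p < k q"
  proof (cases "p \<le> 1/2 \<or> 1/2 \<le> q")
    case True
    then show ?thesis using assms by (intro dec) auto
  next
    case False
    then have "k p < k (1/2)" "k (1/2) < k q" using assms by (auto intro!: dec)
    then show ?thesis by simp
  qed
  then show ?thesis using assms by (simp add: k_def ln_div)
qed

text \<open>
  In the variable \<open>m = ln (1 + w / t)\<close> one has \<open>t = w / (exp m - 1)\<close>, so \<open>(t + \<epsilon>) * m\<close> is a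
  convex function of \<open>m\<close> and a stationary point is a global minimum.
\<close>

lemma ex_uniform_exponential_tilt:
  fixes \<epsilon> :: real
  assumes e: "0 < \<epsilon>" "\<epsilon> < 1"
  obtains w c where "w > 0" "c > 2 * \<epsilon>^2"
    "\<And>t. t > 0 \<Longrightarrow> c + ln (1 + w) \<le> (t + \<epsilon>) * ln (1 + w / t)"
proof -
  \<comment> \<open>\<open>\<psi>\<close> is the derivative of \<open>t \<mapsto> kl(t + \<epsilon>, t)\<close>; it changes sign between \<open>t\<^sub>0\<close> and \<open>t\<^sub>1\<close>\<close>
  define \<psi> where "\<psi> = (\<lambda>t. ln ((t + \<epsilon>) / t * ((1 - t) / (1 - \<epsilon> - t))) - \<epsilon> / (t * (1 - t)))"
  define t\<^sub>0 where "t\<^sub>0 = (1 - \<epsilon>) / 2"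
  \<comment> \<open>The choice makes ln (\<epsilon> / \<eta>) equal to 1 / \<open>t\<^sub>0\<close>,
    which dominates \<epsilon> / (t (1 - t)) for \<open>t\<^sub>0\<close> \<le> t \<le> 1 -
    \<epsilon>. At \<open>t\<^sub>1\<close> the logarithm in \<psi> therefore wins.\<close>
  define \<eta> where "\<eta> = \<epsilon> * exp (- (2 / (1 - \<epsilon>)))"
  define t\<^sub>1 where "t\<^sub>1 = 1 - \<epsilon> - \<eta>"
  have "exp (- (2 / (1 - \<epsilon>))) \<le> (1 - \<epsilon>) / 2"
  proof -
    have "2 / (1 - \<epsilon>) \<le> exp (2 / (1 - \<epsilon>))"
      using exp_ge_add_one_self[of "2 / (1 - \<epsilon>)"] by linarith
    then show ?thesis using e by (simp add: exp_minus field_simps)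
  qed
  then have "\<eta> \<le> 1 * ((1 - \<epsilon>) / 2)"
    unfolding \<eta>_def using e by (intro mult_mono) auto
  then have t01: "0 < t\<^sub>0" "t\<^sub>0 \<le> t\<^sub>1" "t\<^sub>1 < 1 - \<epsilon>"
    using e by (auto simp: t\<^sub>0_def t\<^sub>1_def \<eta>_def field_simps)
  have "\<psi> t\<^sub>0 \<le> 0"
  proof -
    \<comment> \<open>\<open>t\<^sub>0\<close> is the symmetric point
      \<open>t\<^sub>0 + \<epsilon> = 1 - t\<^sub>0\<close>. Both quotients inside the logarithm
      equal \<open>x\<close> there, and the claim becomes 2 ln x \<le> x - 1 / x.\<close>
    define x where "x = (1 + \<epsilon>) / (1 - \<epsilon>)"
    have x: "1 \<le> x" using e by (simp add: x_def field_simps)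
    have lnx: "ln x \<le> (x - 1 / x) / 2"
    proof -
      let ?g = "\<lambda>x::real. (x - 1 / x) / 2 - ln x"
      have "?g 1 \<le> ?g x"
      proof (rule DERIV_nonneg_imp_nondecreasing[OF x])
        fix y :: real assume y: "1 \<le> y"
        have "(?g has_real_derivative ((y - 1) / y)^2 / 2) (at y)"
          using y by (auto intro!: derivative_eq_intros simp: field_simps power2_eq_square)
        then show "\<exists>d. (?g has_real_derivative d) (at y) \<and> 0 \<le> d"
          by (intro exI[of _ "((y - 1) / y)^2 / 2"]) auto
      qed
      then show ?thesis by simp
    qed
    have "(t\<^sub>0 + \<epsilon>) / t\<^sub>0 = x" "(1 - t\<^sub>0) / (1 - \<epsilon> - t\<^sub>0) = x"
      using e by (simp_all add: t\<^sub>0_def x_def field_simps)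
    moreover have "\<epsilon> / (t\<^sub>0 * (1 - t\<^sub>0)) = x - 1 / x"
      using e by (simp add: t\<^sub>0_def x_def divide_simps) algebra
    ultimately have "\<psi> t\<^sub>0 = ln (x * x) - (x - 1 / x)" unfolding \<psi>_def by simp
    then show ?thesis using x lnx by (simp add: ln_mult)
  qed
  moreover have "0 \<le> \<psi> t\<^sub>1"
  proof -
    have "\<epsilon> / (t\<^sub>1 * (1 - t\<^sub>1)) \<le> \<epsilon> / (t\<^sub>0 * \<epsilon>)"
      using t01 e by (intro divide_left_mono mult_mono mult_pos_pos) auto
    also have "\<dots> = ln (\<epsilon> / \<eta>)"
      using e by (simp add: t\<^sub>0_def \<eta>_def exp_minus field_simps)
    also have "\<dots> \<le> ln ((t\<^sub>1 + \<epsilon>) / t\<^sub>1 * ((1 - t\<^sub>1) / (1 - \<epsilon> - t\<^sub>1)))"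
    proof -
      have \<eta>: "0 < \<eta>" "1 - \<epsilon> - t\<^sub>1 = \<eta>" using e by (auto simp: \<eta>_def t\<^sub>1_def)
      then have "1 * (\<epsilon> / \<eta>) \<le> (t\<^sub>1 + \<epsilon>) / t\<^sub>1 * ((1 - t\<^sub>1) / (1 - \<epsilon> - t\<^sub>1))"
        using t01 e by (intro mult_mono) (auto intro!: divide_right_mono)
      moreover have "0 < \<epsilon> / \<eta>" using \<eta> e by simp
      ultimately show ?thesis by (subst ln_le_cancel_iff) linarith+
    qed
    finally show ?thesis by (simp add: \<psi>_def)
  qed
  moreover have "continuous_on {t\<^sub>0..t\<^sub>1} \<psi>"
    unfolding \<psi>_def using t01 e by (intro continuous_intros) auto
  ultimately obtain s where s: "t\<^sub>0 \<le> s" "s \<le> t\<^sub>1" "\<psi> s = 0"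
    using IVT'[of \<psi> t\<^sub>0 0 t\<^sub>1] t01 by auto
  then have s01: "0 < s" "s < 1 - \<epsilon>" using t01 by auto
  \<comment> \<open>the optimal exponential tilt for a Bernoulli variable with mean \<open>s\<close> to exceed \<open>s + \<epsilon>\<close>\<close>
  define w where "w = \<epsilon> / (1 - \<epsilon> - s)"
  have w: "w > 0" using s01 e by (simp add: w_def)
  define \<l> where "\<l> = ln (1 + w / s)"
  have odds: "1 + w / s = (s + \<epsilon>) / s * ((1 - s) / (1 - \<epsilon> - s))"
    using s01 by (simp add: w_def divide_simps) algebra
  \<comment> \<open>Stationarity of \<open>s\<close> enters here: \<psi> s = 0 gives the log odds
    ratio this value.\<close>
  have l: "\<l> = \<epsilon> / (s * (1 - s))"
    using s(3) odds by (simp add: \<psi>_def \<l>_def)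
  have l0: "\<l> > 0" using l s01 e by simp
  have expl: "exp \<l> = 1 + w / s" using w s01 by (simp add: \<l>_def add_pos_pos)
  define b where "b = (\<lambda>m::real. m / (exp m - 1))"
  \<comment> \<open>This slope says that \<epsilon> m + w b(m), which is (t + \<epsilon>) m for t =
    w / (exp m - 1), is stationary at \<open>\<l>\<close>.\<close>
  have db: "(b has_real_derivative - \<epsilon> / w) (at \<l>)"
  proof -
    have "exp \<l> - 1 \<noteq> 0" using l0 by simp
    then have "(b has_real_derivative (exp \<l> - 1 - \<l> * exp \<l>) / (exp \<l> - 1)^2) (at \<l>)"
      unfolding b_def by (auto intro!: derivative_eq_intros simp: power2_eq_square)
    also have "(exp \<l> - 1 - \<l> * exp \<l>) / (exp \<l> - 1)^2 = (s / w) * (1 - \<l> * (s + w) / w)"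
      unfolding expl using w s01 by (simp add: field_simps power2_eq_square)
    also have "\<l> * (s + w) / w = (s + \<epsilon>) / s"
    proof -
      have "s + w = (s + \<epsilon>) * (1 - s) / (1 - \<epsilon> - s)"
        using s01 by (simp add: w_def divide_simps) algebra
      then show ?thesis unfolding l using s01 e by (simp add: w_def)
    qed
    also have "(s / w) * (1 - (s + \<epsilon>) / s) = - \<epsilon> / w"
      using w s01 by (simp add: field_simps)
    finally show ?thesis .
  qed
  define c where "c = (s + \<epsilon>) * ln (1 + w / s) - ln (1 + w)"
  show ?thesis
  proof (rule that[OF w])
    have "2 * \<epsilon>^2 < (s + \<epsilon>) * ln ((s + \<epsilon>) / s) + (1 - (s + \<epsilon>)) * ln ((1 - (s + \<epsilon>)) / (1 - s))"
      using binary_kl_gt[of s "s + \<epsilon>"] s01 e by simp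
    also have "\<dots> = c"
    proof -
      have "1 + w = (1 - s) / (1 - \<epsilon> - s)" using s01 by (simp add: w_def field_simps)
      moreover have "ln (1 + w / s) = ln ((s + \<epsilon>) / s) + ln ((1 - s) / (1 - \<epsilon> - s))"
        unfolding odds using s01 e by (subst ln_mult) auto
      moreover have "(1 - (s + \<epsilon>)) / (1 - s) = inverse ((1 - s) / (1 - \<epsilon> - s))"
        by (simp add: algebra_simps)
      then have "ln ((1 - (s + \<epsilon>)) / (1 - s)) = - ln ((1 - s) / (1 - \<epsilon> - s))"
        by (simp only: ln_inverse)
      ultimately show ?thesis
        unfolding c_def by (simp add: algebra_simps)
    qed
    finally show "c > 2 * \<epsilon>^2" .
    fix t :: real assume t: "t > 0"
    define m where "m = ln (1 + w / t)"
    have m0: "m > 0" unfolding m_def using w t by (intro ln_gt_zero) simp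
    have expm: "exp m = 1 + w / t" using w t by (simp add: m_def add_pos_pos)
    have "(- \<epsilon> / w) * (m - \<l>) \<le> b m - b \<l>"
      by (rule convex_on_imp_above_tangent[where A = "{0<..}"])
        (use l0 m0 db convex_on_bernoulli in \<open>auto simp: b_def interior_open has_field_derivative_at_within\<close>)
    then have "\<epsilon> * \<l> + w * b \<l> \<le> \<epsilon> * m + w * b m"
      using w by (simp add: field_simps)
    moreover have "w * b \<l> = s * \<l>" "w * b m = t * m"
      unfolding b_def expl expm using w by auto
    ultimately have "(s + \<epsilon>) * \<l> \<le> (t + \<epsilon>) * m" by (simp add: algebra_simps)
    then show "c + ln (1 + w) \<le> (t + \<epsilon>) * ln (1 + w / t)"
      by (simp add: c_def \<l>_def m_def)
  qed
qed

section \<open>The one-sided DKW inequality\<close>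

text \<open>The martingale property without conditional expectations: \<phi> stands for the past,
  which only sees that a coordinate lies in \<open>A\<close>, not where. On \<open>A\<close> it is
  thus constant in that coordinate, and only the mass of the factor over \<open>A\<close> counts.
  Fubini allows the factors to be exchanged one coordinate at a time.\<close>

lemma nn_integral_PiM_swap_factors:
  fixes \<mu> :: "'b measure" and f g :: "'b \<Rightarrow> ennreal" and \<phi> :: "('i \<Rightarrow> 'b) \<Rightarrow> ennreal"
  assumes \<mu>: "sigma_finite_measure \<mu>" and "finite I"
    and [measurable]: "f \<in> borel_measurable \<mu>" "g \<in> borel_measurable \<mu>" "A \<in> sets \<mu>"
    and out: "\<And>y. y \<in> space \<mu> \<Longrightarrow> y \<notin> A \<Longrightarrow> f y = g y"
    and inside: "(\<integral>\<^sup>+y. f y * indicator A y \<partial>\<mu>) = (\<integral>\<^sup>+y. g y * indicator A y \<partial>\<mu>)"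
    and "\<phi> \<in> borel_measurable (\<Pi>\<^sub>M i\<in>I. \<mu>)"
    and "\<And>x i y y'. i \<in> I \<Longrightarrow> y \<in> A \<Longrightarrow> y' \<in> A \<Longrightarrow> \<phi> (x(i := y)) = \<phi> (x(i := y'))"
  shows "(\<integral>\<^sup>+x. (\<Prod>i\<in>I. f (x i)) * \<phi> x \<partial>(\<Pi>\<^sub>M i\<in>I. \<mu>)) = (\<integral>\<^sup>+x. (\<Prod>i\<in>I. g (x i)) * \<phi> x \<partial>(\<Pi>\<^sub>M i\<in>I. \<mu>))"
  using assms(2,8,9)
proof (induction I arbitrary: \<phi> rule: finite_induct)
  case (insert i I)
  interpret sigma_finite_measure \<mu> by fact
  interpret product_sigma_finite "\<lambda>_::'i. \<mu>" by unfold_locales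
  note [measurable] = insert.prems(1)
  let ?P = "\<Pi>\<^sub>M i\<in>I. \<mu>"
  have split: "(\<integral>\<^sup>+x. (\<Prod>j\<in>insert i I. h (x j)) * \<phi> x \<partial>(\<Pi>\<^sub>M i\<in>insert i I. \<mu>)) =
      (\<integral>\<^sup>+x. (\<Prod>j\<in>I. h (x j)) * (\<integral>\<^sup>+y. h y * \<phi> (x(i := y)) \<partial>\<mu>) \<partial>?P)"
    if [measurable]: "h \<in> borel_measurable \<mu>" for h
  proof -
    have "(\<integral>\<^sup>+x. (\<Prod>j\<in>insert i I. h (x j)) * \<phi> x \<partial>(\<Pi>\<^sub>M i\<in>insert i I. \<mu>)) =
        (\<integral>\<^sup>+x. (\<integral>\<^sup>+y. (\<Prod>j\<in>insert i I. h ((x(i := y)) j)) * \<phi> (x(i := y)) \<partial>\<mu>) \<partial>?P)"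
      using insert.hyps by (intro product_nn_integral_insert) auto
    also have "\<dots> = (\<integral>\<^sup>+x. (\<integral>\<^sup>+y. (\<Prod>j\<in>I. h (x j)) * (h y * \<phi> (x(i := y))) \<partial>\<mu>) \<partial>?P)"
    proof (intro nn_integral_cong)
      fix x y
      have "(\<Prod>j\<in>I. h ((x(i := y)) j)) = (\<Prod>j\<in>I. h (x j))"
        using insert.hyps by (intro prod.cong) auto
      then show "(\<Prod>j\<in>insert i I. h ((x(i := y)) j)) * \<phi> (x(i := y)) =
          (\<Prod>j\<in>I. h (x j)) * (h y * \<phi> (x(i := y)))"
        using insert.hyps by (simp add: ac_simps)
    qed
    also have "\<dots> = (\<integral>\<^sup>+x. (\<Prod>j\<in>I. h (x j)) * (\<integral>\<^sup>+y. h y * \<phi> (x(i := y)) \<partial>\<mu>) \<partial>?P)"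
    proof (intro nn_integral_cong nn_integral_cmult)
      fix x assume [measurable]: "x \<in> space ?P"
      have [measurable]: "(\<lambda>y. x(i := y)) \<in> measurable \<mu> (\<Pi>\<^sub>M i\<in>insert i I. \<mu>)"
        using measurable_component_update[of x I "\<lambda>_. \<mu>" i] insert.hyps \<open>x \<in> space ?P\<close> by simp
      show "(\<lambda>y. h y * \<phi> (x(i := y))) \<in> borel_measurable \<mu>" by measurable
    qed
    finally show ?thesis .
  qed
  have one: "(\<integral>\<^sup>+y. f y * \<phi> (x(i := y)) \<partial>\<mu>) = (\<integral>\<^sup>+y. g y * \<phi> (x(i := y)) \<partial>\<mu>)"
    if x: "x \<in> space ?P" for x
  proof (cases "A = {}")
    case True
    then show ?thesis using out by (intro nn_integral_cong) simp
  next
    case False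
    then obtain a where a: "a \<in> A" by auto
    have const: "\<phi> (x(i := y)) = \<phi> (x(i := a))" if "y \<in> A" for y
      using insert.prems(2) that a by blast
    have [measurable]: "(\<lambda>y. x(i := y)) \<in> measurable \<mu> (\<Pi>\<^sub>M i\<in>insert i I. \<mu>)"
      using measurable_component_update[of x I "\<lambda>_. \<mu>" i] insert.hyps x by simp
    have *: "(\<integral>\<^sup>+y. h y * \<phi> (x(i := y)) \<partial>\<mu>) =
        (\<integral>\<^sup>+y. h y * \<phi> (x(i := y)) * indicator (- A) y \<partial>\<mu>) + \<phi> (x(i := a)) * (\<integral>\<^sup>+y. h y * indicator A y \<partial>\<mu>)"
      if [measurable]: "h \<in> borel_measurable \<mu>" for h
    proof -
      have "(\<integral>\<^sup>+y. h y * \<phi> (x(i := y)) \<partial>\<mu>) =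
          (\<integral>\<^sup>+y. h y * \<phi> (x(i := y)) * indicator (- A) y + \<phi> (x(i := a)) * (h y * indicator A y) \<partial>\<mu>)"
        by (intro nn_integral_cong) (auto simp: indicator_def const ac_simps)
      also have "\<dots> = (\<integral>\<^sup>+y. h y * \<phi> (x(i := y)) * indicator (- A) y \<partial>\<mu>) +
          \<phi> (x(i := a)) * (\<integral>\<^sup>+y. h y * indicator A y \<partial>\<mu>)"
        by (subst nn_integral_add) (auto intro!: nn_integral_cmult arg_cong2[where f = plus])
      finally show ?thesis .
    qed
    have "(\<integral>\<^sup>+y. f y * \<phi> (x(i := y)) * indicator (- A) y \<partial>\<mu>) =
        (\<integral>\<^sup>+y. g y * \<phi> (x(i := y)) * indicator (- A) y \<partial>\<mu>)"
      using out by (intro nn_integral_cong) (auto simp: indicator_def)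
    then show ?thesis by (simp add: * inside)
  qed
  \<comment> \<open>The induction hypothesis is used with the inner integral as \<phi>: integrating
    out coordinate \<open>i\<close> keeps it constant over \<open>A\<close> in every other
    coordinate. The factor at \<open>i\<close> is exchanged afterwards by
    \<open>one\<close>.\<close>
  have "(\<integral>\<^sup>+x. (\<Prod>j\<in>I. f (x j)) * (\<integral>\<^sup>+y. f y * \<phi> (x(i := y)) \<partial>\<mu>) \<partial>?P) =
      (\<integral>\<^sup>+x. (\<Prod>j\<in>I. g (x j)) * (\<integral>\<^sup>+y. f y * \<phi> (x(i := y)) \<partial>\<mu>) \<partial>?P)"
  proof (rule insert.IH)
    show "(\<lambda>x. \<integral>\<^sup>+y. f y * \<phi> (x(i := y)) \<partial>\<mu>) \<in> borel_measurable ?P"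
      by measurable
    fix x :: "'i \<Rightarrow> 'b" and j y y' assume j: "j \<in> I" and y: "y \<in> A" "y' \<in> A"
    then have "j \<noteq> i" using insert.hyps by auto
    then have twist: "x(j := v, i := z) = x(i := z, j := v)" for v z by (rule fun_upd_twist)
    have "\<phi> (x(j := y, i := z)) = \<phi> (x(j := y', i := z))" for z
      unfolding twist using j y by (intro insert.prems(2)) auto
    then show "(\<integral>\<^sup>+z. f z * \<phi> (x(j := y, i := z)) \<partial>\<mu>) = (\<integral>\<^sup>+z. f z * \<phi> (x(j := y', i := z)) \<partial>\<mu>)"
      by simp
  qed
  also have "\<dots> = (\<integral>\<^sup>+x. (\<Prod>j\<in>I. g (x j)) * (\<integral>\<^sup>+y. g y * \<phi> (x(i := y)) \<partial>\<mu>) \<partial>?P)"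
    by (intro nn_integral_cong) (simp add: one)
  finally show ?case by (simp add: split)
qed simp

text \<open>Doob's maximal inequality for \<open>Y\<close> on a finite set of levels, by first
  passage. The event is cut according to the level \<open>q\<close> where \<open>L\<close> is first
  reached; on each piece \<open>Y q\<close> has the same integral as the terminal
  \<open>Y m\<close>, whose total integral is the right-hand side.\<close>

lemma maximal_tail_likelihood:
  fixes \<mu> :: "real measure" and I :: "'i set" and L :: ennreal
  assumes \<mu>: "prob_space \<mu>" and sets[measurable_cong, simp]: "sets \<mu> = sets borel"
    and I: "finite I" and F: "finite F" and w: "w \<ge> 0"
    and pos: "\<And>q. q \<in> F \<Longrightarrow> measure \<mu> {q<..} > 0"
  defines "Y \<equiv> \<lambda>q x. \<Prod>i\<in>I. 1 + ennreal (w / measure \<mu> {q<..}) * indicator {q<..} (x i)"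
  shows "L * emeasure (\<Pi>\<^sub>M i\<in>I. \<mu>) {x \<in> space (\<Pi>\<^sub>M i\<in>I. \<mu>). \<exists>q\<in>F. L \<le> Y q x} \<le> ennreal (1 + w) ^ card I"
proof (cases "F = {}")
  case False
  interpret prob_space \<mu> by fact
  interpret product_sigma_finite "\<lambda>_::'i. \<mu>" by unfold_locales
  let ?P = "\<Pi>\<^sub>M i\<in>I. \<mu>"
  have space[simp]: "space \<mu> = UNIV" using sets_eq_imp_space_eq[OF sets] by simp
  have Y[measurable]: "Y q \<in> borel_measurable ?P" for q unfolding Y_def by measurable
  define g where "g = (\<lambda>q y. 1 + ennreal (w / measure \<mu> {q<..}) * indicator {q<..} (y::real))"
  have g[measurable]: "g q \<in> borel_measurable \<mu>" for q unfolding g_def by measurable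
  have Yg: "Y q x = (\<Prod>i\<in>I. g q (x i))" for q x by (simp add: Y_def g_def)
  have tilt: "(\<integral>\<^sup>+y. ennreal (w / measure \<mu> {q<..}) * indicator {q<..} y \<partial>\<mu>) = ennreal w" if "q \<in> F" for q
    using pos[OF that] w
    by (subst nn_integral_cmult_indicator) (auto simp: emeasure_eq_measure simp flip: ennreal_mult)
  \<comment> \<open>The mass \<open>w\<close> added by the tilt at \<open>m\<close> lies beyond
    \<open>m\<close>, hence beyond \<open>q\<close>, so the value does not depend on
    \<open>m\<close>. This is what lets \<open>g q\<close> and \<open>g m\<close> be
    swapped.\<close>
  have g_int: "(\<integral>\<^sup>+y. g m y * indicator {q<..} y \<partial>\<mu>) = emeasure \<mu> {q<..} + ennreal w"
    if "m \<in> F" "q \<le> m" for q m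
  proof -
    have "(\<integral>\<^sup>+y. g m y * indicator {q<..} y \<partial>\<mu>) =
        (\<integral>\<^sup>+y. indicator {q<..} y + ennreal (w / measure \<mu> {m<..}) * indicator {m<..} y \<partial>\<mu>)"
      using that by (intro nn_integral_cong) (auto simp: g_def indicator_def)
    also have "\<dots> = emeasure \<mu> {q<..} + ennreal w"
      by (subst nn_integral_add) (auto simp: tilt[OF that(1)])
    finally show ?thesis .
  qed
  define m where "m = Max F"
  have m: "m \<in> F" "\<And>q. q \<in> F \<Longrightarrow> q \<le> m" using False F by (auto simp: m_def)
  \<comment> \<open>\<open>C q\<close>: scanning \<open>F\<close> upwards, the level \<open>L\<close> is first reached at \<open>q\<close>. This event
    does not distinguish values of \<open>x i\<close> beyond \<open>q\<close>, so there \<open>Y q\<close> may be exchanged for \<open>Y m\<close>.\<close>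
  define C where "C = (\<lambda>q. {x \<in> space ?P. L \<le> Y q x \<and> (\<forall>r\<in>F. r < q \<longrightarrow> Y r x < L)})"
  have C[measurable]: "C q \<in> sets ?P" for q
    unfolding C_def using F by measurable
  have Y_upd: "Y r (x(i := y)) = Y r (x(i := y'))" if "r \<le> q" "q < y" "q < y'" for r q x i y y'
    unfolding Y_def using that by (intro prod.cong) (auto simp: indicator_def)
  have key: "L * emeasure ?P (C q) \<le> (\<integral>\<^sup>+x. Y m x * indicator (C q) x \<partial>?P)" if q: "q \<in> F" for q
  proof -
    have "L * emeasure ?P (C q) = (\<integral>\<^sup>+x. L * indicator (C q) x \<partial>?P)"
      by (subst nn_integral_cmult_indicator) auto
    also have "\<dots> \<le> (\<integral>\<^sup>+x. Y q x * indicator (C q) x \<partial>?P)"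
      by (intro nn_integral_mono) (auto simp: C_def indicator_def)
    also have "\<dots> = (\<integral>\<^sup>+x. Y m x * indicator (C q) x \<partial>?P)"
      unfolding Yg
    proof (rule nn_integral_PiM_swap_factors[where A = "{q<..}", OF _ I])
      show "sigma_finite_measure \<mu>" ..
      show "g q y = g m y" if "y \<notin> {q<..}" for y
        using that m(2)[OF q] by (auto simp: g_def indicator_def)
      show "(\<integral>\<^sup>+y. g q y * indicator {q<..} y \<partial>\<mu>) = (\<integral>\<^sup>+y. g m y * indicator {q<..} y \<partial>\<mu>)"
        using g_int[of q q] g_int[of m q] m q by simp
      fix x i y y' assume i: "i \<in> I" and y: "y \<in> {q<..}" "y' \<in> {q<..}"
      have "x(i := y) \<in> space ?P \<longleftrightarrow> x(i := y') \<in> space ?P"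
        using i by (auto simp: space_PiM PiE_def extensional_def)
      then have "x(i := y) \<in> C q \<longleftrightarrow> x(i := y') \<in> C q"
        using Y_upd[of _ q y y' x i] y by (auto simp: C_def)
      then show "indicator (C q) (x(i := y)) = (indicator (C q) (x(i := y')) :: ennreal)"
        by (simp add: indicator_def)
    qed auto
    finally show ?thesis .
  qed
  have disj: "disjoint_family_on C F"
    by (auto simp: disjoint_family_on_def C_def) (metis linorder_neqE_linordered_idom not_le)
  have event: "{x \<in> space ?P. \<exists>q\<in>F. L \<le> Y q x} = (\<Union>q\<in>F. C q)"
  proof -
    have "\<exists>q\<in>F. x \<in> C q" if x: "x \<in> space ?P" "q\<^sub>0 \<in> F" "L \<le> Y q\<^sub>0 x" for x q\<^sub>0
    proof -
      define q where "q = Min {q \<in> F. L \<le> Y q x}"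
      have "q \<in> {q \<in> F. L \<le> Y q x}" unfolding q_def using F x by (intro Min_in) auto
      moreover have "Y r x < L" if "r \<in> F" "r < q" for r
        using that F Min_le[of "{q \<in> F. L \<le> Y q x}" r] by (force simp: q_def not_le[symmetric])
      ultimately show ?thesis using x by (auto simp: C_def)
    qed
    then show ?thesis by (auto simp: C_def)
  qed
  have "L * emeasure ?P (\<Union>q\<in>F. C q) = L * (\<Sum>q\<in>F. emeasure ?P (C q))"
    using F disj C by (subst sum_emeasure) auto
  also have "\<dots> = (\<Sum>q\<in>F. L * emeasure ?P (C q))" by (simp add: sum_distrib_left)
  also have "\<dots> \<le> (\<Sum>q\<in>F. \<integral>\<^sup>+x. Y m x * indicator (C q) x \<partial>?P)"
    by (intro sum_mono key)
  also have "\<dots> = (\<integral>\<^sup>+x. Y m x * (\<Sum>q\<in>F. indicator (C q) x) \<partial>?P)"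
    by (subst nn_integral_sum[symmetric]) (auto simp: sum_distrib_left)
  also have "\<dots> \<le> (\<integral>\<^sup>+x. Y m x \<partial>?P)"
  proof (intro nn_integral_mono)
    fix x
    have "(\<Sum>q\<in>F. indicator (C q) x) = (indicator (\<Union>q\<in>F. C q) x :: ennreal)"
      by (rule indicator_UN_disjoint[OF F disj, symmetric])
    then show "Y m x * (\<Sum>q\<in>F. indicator (C q) x) \<le> Y m x"
      by (simp add: indicator_def)
  qed
  also have "\<dots> = (\<Prod>i\<in>I. \<integral>\<^sup>+y. g m y \<partial>\<mu>)"
    unfolding Yg by (intro product_nn_integral_prod I) auto
  also have "(\<integral>\<^sup>+y. g m y \<partial>\<mu>) = ennreal (1 + w)"
    unfolding g_def using w emeasure_space_1
    by (subst nn_integral_add) (auto simp: tilt[OF m(1)])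
  finally show ?thesis by (simp add: event)
qed simp

text \<open>The bound is on upper tails, so that the opposite deviation follows by applying it to
  \<open>- X\<close>. Strictness of the probability comes from \<open>c > 2 * \<epsilon>^2\<close>.
  A single measurable event serves all \<open>u\<close>, which avoids measuring an uncountable
  intersection.\<close>

lemma (in prob_space) one_sided_DKW_strict:
  fixes X :: "'a \<Rightarrow> real" and Xs :: "nat \<Rightarrow> 'a \<Rightarrow> real"
  assumes n: "n \<ge> 1" and \<epsilon>: "\<epsilon> > 0" and X[measurable]: "random_variable borel X"
    and indep: "indep_vars (\<lambda>_. borel) Xs {1..n}"
    and distr: "\<And>i. i \<in> {1..n} \<Longrightarrow> distr M borel (Xs i) = distr M borel X"
  obtains E where "E \<in> events" "prob E > 1 - exp (- 2 * real n * \<epsilon>^2)"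
    "\<And>\<omega> u. \<omega> \<in> E \<Longrightarrow>
      1 / real n * real (card {i\<in>{1..n}. u < Xs i \<omega>}) \<le> \<P>(\<omega> in M. u < X \<omega>) + \<epsilon>"
proof (cases "\<epsilon> < 1")
  \<comment> \<open>An empirical tail never exceeds 1, so for \<epsilon> \<ge> 1 the whole space
    serves as the event.\<close>
  case False
  have "1 / real n * real (card {i\<in>{1..n}. u < Xs i \<omega>}) \<le> \<P>(\<omega> in M. u < X \<omega>) + \<epsilon>" for u \<omega>
  proof -
    have "card {i\<in>{1..n}. u < Xs i \<omega>} \<le> card {1..n}" by (intro card_mono) auto
    then have "1 / real n * real (card {i\<in>{1..n}. u < Xs i \<omega>}) \<le> 1"
      using n by (simp add: field_simps)
    also have "\<dots> \<le> \<P>(\<omega> in M. u < X \<omega>) + \<epsilon>" using False by (simp add: add_increasing)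
    finally show ?thesis .
  qed
  then show ?thesis using that[of "space M"] prob_space by auto
next
  case True
  obtain w c where w: "w > 0" and c: "c > 2 * \<epsilon>^2"
    and tilt: "\<And>t. t > 0 \<Longrightarrow> c + ln (1 + w) \<le> (t + \<epsilon>) * ln (1 + w / t)"
    using ex_uniform_exponential_tilt[OF \<epsilon> True] by blast
  define \<mu> where "\<mu> = distr M borel X"
  have \<mu>: "prob_space \<mu>" unfolding \<mu>_def by (rule prob_space_distr) simp
  have sets[measurable_cong, simp]: "sets \<mu> = sets borel" by (simp add: \<mu>_def)
  define p where "p = (\<lambda>q. measure \<mu> {q<..})"
  have p: "p q = \<P>(\<omega> in M. q < X \<omega>)" for q
    unfolding p_def \<mu>_def by (subst measure_distr) (auto intro!: arg_cong[where f = prob])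
  have Xs[measurable]: "Xs i \<in> borel_measurable M" if "i \<in> {1..n}" for i
    using indep that by (auto simp: indep_vars_def)
  \<comment> \<open>The threshold for which (1 + w)^n / L = exp (- n c) in the maximal
    inequality.\<close>
  define L where "L = exp (real n * (c + ln (1 + w)))"
  define Y where "Y = (\<lambda>q x. \<Prod>i\<in>{1..n}. 1 + ennreal (w / measure \<mu> {q<..}) * indicator {q<..} (x i))"
  let ?P = "\<Pi>\<^sub>M i\<in>{1..n}. \<mu>"
  have Y_meas[measurable]: "Y q \<in> borel_measurable ?P" for q unfolding Y_def by measurable
  define S where "S = (\<lambda>\<omega>. \<lambda>i\<in>{1..n}. Xs i \<omega>)"
  have S[measurable]: "S \<in> measurable M ?P" unfolding S_def by measurable
  have S_distr: "distr M ?P S = ?P"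
  proof -
    have "distr M (\<Pi>\<^sub>M i\<in>{1..n}. borel) S = (\<Pi>\<^sub>M i\<in>{1..n}. distr M borel (Xs i))"
      unfolding S_def using indep Xs n by (subst indep_vars_iff_distr_eq_PiM'[symmetric]) auto
    also have "\<dots> = ?P" by (intro PiM_cong) (auto simp: distr \<mu>_def)
    finally show ?thesis by (subst distr_cong[OF refl sets_PiM_cong[OF refl sets]]) auto
  qed
  \<comment> \<open>Growing finite sets that exhaust the rationals with positive tail: finite for
    the maximal inequality, increasing so that continuity of measure passes to all of them.\<close>
  define F where "F = (\<lambda>k. {q \<in> from_nat_into \<rat> ` {..k::nat}. 0 < p q})"
  have F: "finite (F k)" for k by (simp add: F_def)
  define B where "B = (\<lambda>k. {\<omega> \<in> space M. \<exists>q\<in>F k. ennreal L \<le> Y q (S \<omega>)})"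
  have B_meas[measurable]: "B k \<in> sets M" for k
    unfolding B_def using F by measurable
  have B_le: "prob (B k) \<le> exp (- real n * c)" for k
  proof -
    let ?B = "{x \<in> space ?P. \<exists>q\<in>F k. ennreal L \<le> Y q x}"
    have [measurable]: "?B \<in> sets ?P" using F by measurable
    have B: "B k = S -` ?B \<inter> space M"
      using measurable_space[OF S] by (auto simp: B_def)
    have "emeasure M (B k) = emeasure (distr M ?P S) ?B"
      unfolding B by (rule emeasure_distr[symmetric]) measurable
    then have "ennreal L * emeasure M (B k) = ennreal L * emeasure ?P ?B"
      by (simp only: S_distr)
    also have "\<dots> \<le> ennreal (1 + w) ^ card {1..n}"
      unfolding Y_def
      by (rule maximal_tail_likelihood[OF \<mu> sets _ F]) (use w in \<open>auto simp: F_def p_def\<close>)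
    finally have "ennreal (L * prob (B k)) \<le> ennreal ((1 + w) ^ n)"
      using w by (simp add: emeasure_eq_measure L_def ennreal_power ennreal_mult del: ennreal_plus)
    then have "L * prob (B k) \<le> (1 + w) ^ n"
      using w by (subst (asm) ennreal_le_iff) auto
    moreover have "(1 + w) ^ n = exp (- real n * c) * L"
      using w by (simp add: L_def algebra_simps exp_of_nat_mult flip: exp_add)
    ultimately show ?thesis by (simp add: L_def mult.commute)
  qed
  define Bad where "Bad = (\<Union>k. B k)"
  have Bad_le: "prob Bad \<le> exp (- real n * c)"
  proof -
    have "incseq B" by (force simp: incseq_def B_def F_def)
    then have "(\<lambda>k. prob (B k)) \<longlonglongrightarrow> prob Bad"
      unfolding Bad_def by (intro finite_Lim_measure_incseq) auto
    then show ?thesis by (rule LIMSEQ_le_const2) (use B_le in auto)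
  qed
  \<comment> \<open>Rational levels with zero tail are missing from every \<open>F k\<close>. Almost
    surely no sample point lies beyond them, and this null set is discarded as
    \<open>N\<close>.\<close>
  have "AE \<omega> in M. \<forall>q\<in>\<rat>. p q = 0 \<longrightarrow> (\<forall>i\<in>{1..n}. \<not> q < Xs i \<omega>)"
  proof (rule AE_ball_countable'[OF _ countable_rat])
    fix q :: real assume "q \<in> \<rat>"
    have "AE \<omega> in M. p q = 0 \<longrightarrow> \<not> q < Xs i \<omega>" if i: "i \<in> {1..n}" for i
    proof (cases "p q = 0")
      case p0: True
      have [measurable]: "Xs i \<in> borel_measurable M" using i by simp
      have "p q = prob {\<omega> \<in> space M. q < Xs i \<omega>}"
        unfolding p_def \<mu>_def distr[OF i, symmetric]
        by (subst measure_distr) (auto intro!: arg_cong[where f = prob])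
      with p0 have "AE \<omega> in M. \<omega> \<notin> {\<omega> \<in> space M. q < Xs i \<omega>}"
        by (subst prob_eq_0[symmetric]) auto
      then show ?thesis by (auto elim!: AE_mp)
    qed simp
    then show "AE \<omega> in M. p q = 0 \<longrightarrow> (\<forall>i\<in>{1..n}. \<not> q < Xs i \<omega>)"
      by (cases "p q = 0") (auto intro: AE_finite_allI)
  qed
  then obtain N where N: "{\<omega> \<in> space M. \<not> (\<forall>q\<in>\<rat>. p q = 0 \<longrightarrow> (\<forall>i\<in>{1..n}. \<not> q < Xs i \<omega>))} \<subseteq> N"
    "emeasure M N = 0" "N \<in> events" by (rule AE_E)
  have [measurable]: "Bad \<in> events" unfolding Bad_def by measurable
  show ?thesis
  proof (rule that)
    show "space M - (Bad \<union> N) \<in> events" using N by auto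
    have "prob (Bad \<union> N) \<le> prob Bad + prob N"
      using N by (intro measure_Un_le) auto
    also have "prob N = 0" using N by (simp add: measure_def)
    also have "prob Bad + 0 \<le> exp (- real n * c)" using Bad_le by simp
    also have "\<dots> < exp (- 2 * real n * \<epsilon>^2)" using c n by simp
    finally show "prob (space M - (Bad \<union> N)) > 1 - exp (- 2 * real n * \<epsilon>^2)"
      using N by (subst prob_compl) auto
  next
    fix \<omega> u assume \<omega>: "\<omega> \<in> space M - (Bad \<union> N)"
    define J where "J = {i\<in>{1..n}. u < Xs i \<omega>}"
    have "real (card J) \<le> real n * (p u + \<epsilon>)"
    proof (cases "J = {}")
      case True
      then show ?thesis using \<epsilon> by (simp add: p_def)
    next
      case False
      have J: "finite J" by (simp add: J_def)
      \<comment> \<open>Any rational strictly between \<open>u\<close> and the smallest sample point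
        above \<open>u\<close> selects the same sample points, while its true tail is at most that
        of \<open>u\<close>. Hence rational levels suffice.\<close>
      define m where "m = Min ((\<lambda>i. Xs i \<omega>) ` J)"
      have "m \<in> (\<lambda>i. Xs i \<omega>) ` J" unfolding m_def using J False by (intro Min_in) auto
      then have "u < m" by (auto simp: J_def)
      then obtain q where q: "q \<in> \<rat>" "u < q" "q < m" using Rats_dense_in_real by blast
      have q_less: "q < Xs i \<omega>" if "i \<in> J" for i
      proof -
        have "m \<le> Xs i \<omega>" unfolding m_def using that J by (intro Min_le) auto
        then show ?thesis using q by simp
      qed
      have Jq: "J = {i\<in>{1..n}. q < Xs i \<omega>}"
        using q_less q by (auto simp: J_def)
      have "p q \<noteq> 0"
        using N(1) \<omega> q q_less False by (fastforce simp: J_def)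
      then have pq: "p q > 0" by (simp add: p_def zero_less_measure_iff)
      obtain k where "q = from_nat_into \<rat> k"
        using from_nat_into_surj[OF countable_rat q(1)] by metis
      then have "q \<in> F k" using pq by (auto simp: F_def)
      then have Y_less: "Y q (S \<omega>) < ennreal L"
        using \<omega> by (auto simp: Bad_def B_def not_le)
      have "Y q (S \<omega>) = (\<Prod>i\<in>{1..n}. if q < Xs i \<omega> then ennreal (1 + w / p q) else 1)"
        unfolding Y_def S_def using w pq
        by (intro prod.cong) (auto simp: p_def)
      also have "\<dots> = ennreal ((1 + w / p q) ^ card J)"
        using w pq by (simp add: prod.If_cases Jq ennreal_power Int_def conj_commute del: ennreal_plus)
      finally have "(1 + w / p q) ^ card J < L"
        using Y_less by (simp add: L_def ennreal_less_iff w pq less_imp_le)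
      moreover have gt: "1 + w / p q > 1" using w pq by simp
      \<comment> \<open>After taking logarithms, \<open>tilt\<close> at t = \<open>p q\<close>
        bounds the right side by a multiple of ln (1 + w / p q), and this positive factor
        cancels.\<close>
      ultimately have "real (card J) * ln (1 + w / p q) < real n * (c + ln (1 + w))"
        using ln_less_cancel_iff[of "(1 + w / p q) ^ card J" L] by (simp add: L_def ln_realpow)
      also have "\<dots> \<le> real n * ((p q + \<epsilon>) * ln (1 + w / p q))"
        using tilt[OF pq] by (intro mult_left_mono) auto
      finally have "real (card J) \<le> real n * (p q + \<epsilon>)"
        using ln_gt_zero[OF gt] by simp
      also have "p q \<le> p u"
        unfolding p using q by (intro finite_measure_mono) auto
      finally show ?thesis using n by simp
    qed
    then show "1 / real n * real (card {i\<in>{1..n}. u < Xs i \<omega>}) \<le> \<P>(\<omega> in M. u < X \<omega>) + \<epsilon>"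
      using n by (simp add: p J_def field_simps)
  qed
qed

section \<open>From tails to CVaR\<close>

lemma ennreal_clamp_eq_nn_integral:
  fixes w v x :: real
  assumes "w \<le> v"
  shows "ennreal (max (x - w) 0 - max (x - v) 0) = (\<integral>\<^sup>+u. indicator {w..<v} u * indicator {u. u < x} u \<partial>lborel)"
proof -
  have "(\<integral>\<^sup>+u. indicator {w..<v} u * indicator {u. u < x} u \<partial>lborel) = (\<integral>\<^sup>+u. indicator {w..<min v x} u \<partial>lborel)"
    by (intro nn_integral_cong) (auto simp: indicator_def)
  also have "\<dots> = ennreal (max (x - w) 0 - max (x - v) 0)"
    using assms by (cases "w \<le> x") (auto simp: min_def max_def ennreal_neg)
  finally show ?thesis ..
qed

text \<open>The integrand is \<open>X\<close> clamped to [w, v], measured from \<open>w\<close>: the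
  length of the part of [w, v) below \<open>X\<close>. Tonelli turns its mean into an integral of
  the tail over a bounded interval.\<close>

lemma (in prob_space) nn_integral_clamp:
  fixes X :: "'a \<Rightarrow> real"
  assumes [measurable]: "random_variable borel X" and "w \<le> v"
  shows "(\<integral>\<^sup>+\<omega>. ennreal (max (X \<omega> - w) 0 - max (X \<omega> - v) 0) \<partial>M) =
    (\<integral>\<^sup>+u. indicator {w..<v} u * ennreal (\<P>(\<omega> in M. u < X \<omega>)) \<partial>lborel)"
proof -
  interpret pair_sigma_finite M lborel by unfold_locales
  have "(\<integral>\<^sup>+\<omega>. ennreal (max (X \<omega> - w) 0 - max (X \<omega> - v) 0) \<partial>M) =
      (\<integral>\<^sup>+\<omega>. (\<integral>\<^sup>+u. indicator {w..<v} u * indicator {u. u < X \<omega>} u \<partial>lborel) \<partial>M)"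
    by (simp add: ennreal_clamp_eq_nn_integral assms)
  also have "\<dots> = (\<integral>\<^sup>+u. (\<integral>\<^sup>+\<omega>. indicator {w..<v} u * indicator {u. u < X \<omega>} u \<partial>M) \<partial>lborel)"
    by (intro Fubini'[symmetric]) (simp add: indicator_def)
  also have "\<dots> = (\<integral>\<^sup>+u. indicator {w..<v} u * ennreal (\<P>(\<omega> in M. u < X \<omega>)) \<partial>lborel)"
  proof (intro nn_integral_cong)
    fix u :: real
    have "(\<integral>\<^sup>+\<omega>. indicator {w..<v} u * indicator {u. u < X \<omega>} u \<partial>M) =
        (\<integral>\<^sup>+\<omega>. indicator {w..<v} u * indicator {\<omega> \<in> space M. u < X \<omega>} \<omega> \<partial>M)"
      by (intro nn_integral_cong) (auto simp: indicator_def)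
    also have "\<dots> = indicator {w..<v} u * ennreal (\<P>(\<omega> in M. u < X \<omega>))"
      by (subst nn_integral_cmult_indicator) (auto simp: emeasure_eq_measure)
    finally show "(\<integral>\<^sup>+\<omega>. indicator {w..<v} u * indicator {u. u < X \<omega>} u \<partial>M) = \<dots>" .
  qed
  finally show ?thesis .
qed

text \<open>A tail error of at most \<epsilon> at each level accumulates to \<epsilon> (v - w) over
  [w, v]. Neither law is tied to the sample, so the lemma serves both deviations.\<close>

lemma expectation_clamp_le:
  fixes X :: "'a \<Rightarrow> real" and Y :: "'b \<Rightarrow> real"
  assumes M: "prob_space M" and N: "prob_space N"
    and X: "integrable M X" and Y: "integrable N Y" and "w \<le> v" and \<epsilon>: "\<epsilon> \<ge> 0"
    and le: "\<And>u. \<P>(y in N. u < Y y) \<le> \<P>(x in M. u < X x) + \<epsilon>"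
  shows "(\<integral>y. max (Y y - w) 0 \<partial>N) - (\<integral>y. max (Y y - v) 0 \<partial>N) \<le>
    (\<integral>x. max (X x - w) 0 \<partial>M) - (\<integral>x. max (X x - v) 0 \<partial>M) + \<epsilon> * (v - w)"
proof -
  interpret M: prob_space M by fact
  interpret N: prob_space N by fact
  have eq: "ennreal ((\<integral>x. max (Z x - w) 0 \<partial>K) - (\<integral>x. max (Z x - v) 0 \<partial>K)) =
      (\<integral>\<^sup>+x. ennreal (max (Z x - w) 0 - max (Z x - v) 0) \<partial>K)"
    and nonneg: "0 \<le> (\<integral>x. max (Z x - w) 0 \<partial>K) - (\<integral>x. max (Z x - v) 0 \<partial>K)"
    if K: "prob_space K" "integrable K Z" for K :: "'c measure" and Z :: "'c \<Rightarrow> real"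
  proof -
    interpret prob_space K by fact
    have i: "integrable K (\<lambda>x. max (Z x - w) 0)" "integrable K (\<lambda>x. max (Z x - v) 0)"
      using K by auto
    show "ennreal ((\<integral>x. max (Z x - w) 0 \<partial>K) - (\<integral>x. max (Z x - v) 0 \<partial>K)) =
      (\<integral>\<^sup>+x. ennreal (max (Z x - w) 0 - max (Z x - v) 0) \<partial>K)"
      using i \<open>w \<le> v\<close> by (subst nn_integral_eq_integral) auto
    show "0 \<le> (\<integral>x. max (Z x - w) 0 \<partial>K) - (\<integral>x. max (Z x - v) 0 \<partial>K)"
      using i \<open>w \<le> v\<close> by (auto intro!: integral_mono)
  qed
  have [measurable]: "X \<in> borel_measurable M" "Y \<in> borel_measurable N" using X Y by auto
  have "(\<integral>\<^sup>+y. ennreal (max (Y y - w) 0 - max (Y y - v) 0) \<partial>N) =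
      (\<integral>\<^sup>+u. indicator {w..<v} u * ennreal (\<P>(y in N. u < Y y)) \<partial>lborel)"
    by (intro N.nn_integral_clamp \<open>w \<le> v\<close>) simp
  also have "\<dots> \<le> (\<integral>\<^sup>+u. indicator {w..<v} u * ennreal (\<P>(x in M. u < X x)) + ennreal \<epsilon> * indicator {w..<v} u \<partial>lborel)"
    using \<epsilon> le by (intro nn_integral_mono) (auto simp: indicator_def simp flip: ennreal_plus intro!: ennreal_leI)
  also have "\<dots> = (\<integral>\<^sup>+u. indicator {w..<v} u * ennreal (\<P>(x in M. u < X x)) \<partial>lborel) + ennreal \<epsilon> * ennreal (v - w)"
    using \<open>w \<le> v\<close> by (subst nn_integral_add) (auto simp: nn_integral_cmult_indicator)
  also have "(\<integral>\<^sup>+u. indicator {w..<v} u * ennreal (\<P>(x in M. u < X x)) \<partial>lborel) =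
      (\<integral>\<^sup>+x. ennreal (max (X x - w) 0 - max (X x - v) 0) \<partial>M)"
    by (intro M.nn_integral_clamp[symmetric] \<open>w \<le> v\<close>) simp
  finally have "ennreal ((\<integral>y. max (Y y - w) 0 \<partial>N) - (\<integral>y. max (Y y - v) 0 \<partial>N)) \<le>
      ennreal ((\<integral>x. max (X x - w) 0 \<partial>M) - (\<integral>x. max (X x - v) 0 \<partial>M) + \<epsilon> * (v - w))"
    using nonneg[OF M X] \<epsilon> \<open>w \<le> v\<close>
    by (simp add: eq[OF M X, symmetric] eq[OF N Y, symmetric] flip: ennreal_mult ennreal_plus)
  then show ?thesis
    using nonneg[OF M X] \<epsilon> \<open>w \<le> v\<close> by (subst (asm) ennreal_le_iff) auto
qed

text \<open>By density of the rationals and continuity. It makes the sample CVaR a countable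
  infimum, hence measurable.\<close>

lemma INF_real_eq_INF_Rats:
  fixes f :: "real \<Rightarrow> real"
  assumes cont: "continuous_on UNIV f" and bdd: "bdd_below (range f)"
  shows "(INF w. f w) = (INF w\<in>\<rat>. f w)"
proof (rule antisym)
  show "(INF w. f w) \<le> (INF w\<in>\<rat>. f w)"
    using bdd by (intro cINF_superset_mono) (auto intro: Rats_0)
  show "(INF w\<in>\<rat>. f w) \<le> (INF w. f w)"
  proof (rule cINF_greatest)
    have "bdd_below (f ` \<rat>)" using bdd by (rule bdd_below_mono) auto
    then have "\<rat> \<subseteq> {w. (INF w\<in>\<rat>. f w) \<le> f w}" by (auto intro: cINF_lower)
    moreover have "closed {w. (INF w\<in>\<rat>. f w) \<le> f w}"
      by (intro closed_Collect_le continuous_on_const cont)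
    ultimately have "closure \<rat> \<subseteq> {w. (INF w\<in>\<rat>. f w) \<le> f w}" by (rule closure_minimal)
    then show "(INF w\<in>\<rat>. f w) \<le> f w" for w by (auto simp: Rats_closure_real)
  qed simp
qed

section \<open>Comparison of CVaR under two fixed laws\<close>

lemma (in prob_space) CVaR_le:
  assumes "integrable M X" "0 < \<alpha>" "\<alpha> \<le> 1"
  shows "CVaR M \<alpha> X \<le> w + 1 / \<alpha> * (\<integral>\<omega>. max (X \<omega> - w) 0 \<partial>M)"
  unfolding CVaR_def
  by (rule cINF_lower[OF bdd_belowI2[OF CVaR_objective_ge[OF assms]]]) simp

text \<open>After multiplication by the level, objectives at different levels differ only in the
  linear term, which is where \<epsilon> (v - w) can be absorbed.\<close>

lemma CVaR_ge_scaled: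
  assumes "0 < \<alpha>" and "\<And>w. c \<le> \<alpha> * w + (\<integral>\<omega>. max (X \<omega> - w) 0 \<partial>M)"
  shows "c / \<alpha> \<le> CVaR M \<alpha> X"
  unfolding CVaR_def by (rule cINF_greatest) (use assms in \<open>simp_all add: field_simps\<close>)

lemma CVaR_le_AE_bound:
  assumes "prob_space M" "integrable M X" "0 < \<alpha>" "\<alpha> \<le> 1" "AE \<omega> in M. X \<omega> \<le> b"
  shows "CVaR M \<alpha> X \<le> b"
proof -
  interpret prob_space M by fact
  have "(\<integral>\<omega>. max (X \<omega> - b) 0 \<partial>M) = 0"
    using assms(5) by (intro integral_eq_zero_AE) (auto simp: max_def)
  then show ?thesis using CVaR_le[OF assms(2-4), of b] by simp
qed

text \<open>For w \<le> b take v = b, where the excess of \<open>X\<close> vanishes: \<epsilon> (b -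
  w) turns \<alpha> w into (\<alpha> - \<epsilon>) w + \<epsilon> b. For w > b the bound CVaR \<le>
  b is enough.\<close>

lemma CVaR_upper_bound:
  fixes X :: "'a \<Rightarrow> real" and Y :: "'b \<Rightarrow> real"
  assumes M: "prob_space M" and N: "prob_space N"
    and X: "integrable M X" and Y: "integrable N Y"
    and \<alpha>: "\<alpha> \<le> 1" and \<epsilon>: "0 < \<epsilon>" "\<epsilon> < \<alpha>" and b: "AE x in M. X x \<le> b"
    and clamp: "\<And>w v. w \<le> v \<Longrightarrow> (\<integral>x. max (X x - w) 0 \<partial>M) - (\<integral>x. max (X x - v) 0 \<partial>M) \<le>
      (\<integral>y. max (Y y - w) 0 \<partial>N) - (\<integral>y. max (Y y - v) 0 \<partial>N) + \<epsilon> * (v - w)"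
  shows "CVaR M \<alpha> X \<le> (1 - \<epsilon> / \<alpha>) * CVaR N (\<alpha> - \<epsilon>) Y + \<epsilon> / \<alpha> * b"
proof -
  interpret M: prob_space M by fact
  interpret N: prob_space N by fact
  have nonneg: "0 \<le> (\<integral>y. max (Y y - w) 0 \<partial>N)" for w by (intro integral_nonneg_AE) auto
  have "(\<alpha> * CVaR M \<alpha> X - \<epsilon> * b) / (\<alpha> - \<epsilon>) \<le> CVaR N (\<alpha> - \<epsilon>) Y"
  proof (rule CVaR_ge_scaled)
    fix w
    show "\<alpha> * CVaR M \<alpha> X - \<epsilon> * b \<le> (\<alpha> - \<epsilon>) * w + (\<integral>y. max (Y y - w) 0 \<partial>N)"
    proof (cases "w \<le> b")
      case True
      have "(\<integral>x. max (X x - b) 0 \<partial>M) = 0"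
        using b by (intro integral_eq_zero_AE) (auto simp: max_def)
      then have "(\<integral>x. max (X x - w) 0 \<partial>M) \<le> (\<integral>y. max (Y y - w) 0 \<partial>N) + \<epsilon> * (b - w)"
        using clamp[OF True] nonneg[of b] by linarith
      moreover have "\<alpha> * CVaR M \<alpha> X \<le> \<alpha> * (w + 1 / \<alpha> * (\<integral>x. max (X x - w) 0 \<partial>M))"
        using M.CVaR_le[OF X _ \<alpha>] \<epsilon> by (intro mult_left_mono) auto
      ultimately show ?thesis using \<epsilon> by (simp add: algebra_simps)
    next
      case False
      have "\<alpha> * CVaR M \<alpha> X \<le> \<alpha> * b"
        using CVaR_le_AE_bound[OF M X _ \<alpha> b] \<epsilon> by (intro mult_left_mono) auto
      moreover have "(\<alpha> - \<epsilon>) * b \<le> (\<alpha> - \<epsilon>) * w" using False \<epsilon> by (intro mult_left_mono) auto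
      ultimately show ?thesis using nonneg[of w] unfolding left_diff_distrib by linarith
    qed
  qed (use \<epsilon> in simp)
  then show ?thesis using \<epsilon> by (simp add: field_simps)
qed

text \<open>Every value of the scaled objective of \<open>X\<close> at level \<alpha> (at
  \<open>w\<close>) plus one of \<open>Y\<close> at level \<epsilon> (at \<open>v\<close>) dominates
  the scaled CVaR of \<open>Y\<close> at level \<alpha> + \<epsilon>. For w \<le> v this is
  \<open>clamp\<close> with the objective taken at \<open>w\<close>; otherwise the objective is
  taken at \<open>v\<close>. Infima over \<open>v\<close>, then over \<open>w\<close>,
  finish.\<close>

lemma CVaR_lower_bound:
  fixes X :: "'a \<Rightarrow> real" and Y :: "'b \<Rightarrow> real"
  assumes M: "prob_space M" and N: "prob_space N"
    and X: "integrable M X" and Y: "integrable N Y"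
    and \<alpha>: "0 < \<alpha>" and \<epsilon>: "0 < \<epsilon>" "\<alpha> + \<epsilon> \<le> 1"
    and clamp: "\<And>w v. w \<le> v \<Longrightarrow> (\<integral>y. max (Y y - w) 0 \<partial>N) - (\<integral>y. max (Y y - v) 0 \<partial>N) \<le>
      (\<integral>x. max (X x - w) 0 \<partial>M) - (\<integral>x. max (X x - v) 0 \<partial>M) + \<epsilon> * (v - w)"
  shows "(1 + \<epsilon> / \<alpha>) * CVaR N (\<alpha> + \<epsilon>) Y - \<epsilon> / \<alpha> * CVaR N \<epsilon> Y \<le> CVaR M \<alpha> X"
proof -
  interpret M: prob_space M by fact
  interpret N: prob_space N by fact
  define f where "f = (\<lambda>w. \<integral>x. max (X x - w) 0 \<partial>M)"
  define g where "g = (\<lambda>w. \<integral>y. max (Y y - w) 0 \<partial>N)"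
  have f: "0 \<le> f w" for w unfolding f_def by (intro integral_nonneg_AE) auto
  let ?c = "(\<alpha> + \<epsilon>) * CVaR N (\<alpha> + \<epsilon>) Y"
  have c: "?c \<le> (\<alpha> + \<epsilon>) * w + g w" for w
  proof -
    have "?c \<le> (\<alpha> + \<epsilon>) * (w + 1 / (\<alpha> + \<epsilon>) * g w)"
      unfolding g_def using N.CVaR_le[OF Y] \<alpha> \<epsilon> by (intro mult_left_mono) auto
    moreover have "\<alpha> + \<epsilon> \<noteq> 0" using \<alpha> \<epsilon> by simp
    then have "(\<alpha> + \<epsilon>) * (1 / (\<alpha> + \<epsilon>) * g w) = g w" by simp
    ultimately show ?thesis unfolding distrib_left[of "\<alpha> + \<epsilon>"] by simp
  qed
  have key: "?c \<le> \<alpha> * w + f w + (\<epsilon> * v + g v)" for w v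
  proof (cases "w \<le> v")
    case True
    then have "g w \<le> f w + g v + \<epsilon> * (v - w)"
      using clamp[OF True] f[of v] unfolding f_def g_def by linarith
    then show ?thesis using c[of w] by (simp add: algebra_simps)
  next
    case False
    then have "\<alpha> * v \<le> \<alpha> * w" using \<alpha> by (intro mult_left_mono) auto
    then show ?thesis using c[of v] f[of w] by (simp add: algebra_simps)
  qed
  have "(?c - \<epsilon> * CVaR N \<epsilon> Y) / \<alpha> \<le> CVaR M \<alpha> X"
  proof (rule CVaR_ge_scaled)
    fix w
    have "(?c - (\<alpha> * w + f w)) / \<epsilon> \<le> CVaR N \<epsilon> Y"
      by (rule CVaR_ge_scaled) (use key[of w] \<epsilon> in \<open>simp_all add: g_def algebra_simps\<close>)
    then show "?c - \<epsilon> * CVaR N \<epsilon> Y \<le> \<alpha> * w + (\<integral>x. max (X x - w) 0 \<partial>M)"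
      using \<epsilon> by (simp add: f_def field_simps)
  qed (use \<alpha> in simp)
  also have "(?c - \<epsilon> * CVaR N \<epsilon> Y) / \<alpha> =
      (1 + \<epsilon> / \<alpha>) * CVaR N (\<alpha> + \<epsilon>) Y - \<epsilon> / \<alpha> * CVaR N \<epsilon> Y"
    using \<alpha> by (simp add: field_simps)
  finally show ?thesis .
qed

text \<open>The level \<alpha> + \<epsilon> is capped at 1, where the objective is bounded below by
  the mean of \<open>Y\<close>. The surplus (\<alpha> + \<epsilon> - 1) w is bounded below through w
  \<ge> a.\<close>

lemma CVaR_lower_bound_AE:
  fixes X :: "'a \<Rightarrow> real" and Y :: "'b \<Rightarrow> real"
  assumes M: "prob_space M" and N: "prob_space N"
    and X: "integrable M X" and Y: "integrable N Y"
    and \<alpha>: "0 < \<alpha>" "\<alpha> \<le> 1" and \<epsilon>: "0 < \<epsilon>" "\<epsilon> \<le> 1" "1 \<le> \<alpha> + \<epsilon>" and a: "AE x in M. a \<le> X x"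
    and clamp: "\<And>w v. w \<le> v \<Longrightarrow> (\<integral>y. max (Y y - w) 0 \<partial>N) - (\<integral>y. max (Y y - v) 0 \<partial>N) \<le>
      (\<integral>x. max (X x - w) 0 \<partial>M) - (\<integral>x. max (X x - v) 0 \<partial>M) + \<epsilon> * (v - w)"
  shows "1 / \<alpha> * ((\<alpha> + \<epsilon> - 1) * a + (\<integral>y. Y y \<partial>N) - \<epsilon> * CVaR N \<epsilon> Y) \<le> CVaR M \<alpha> X"
proof -
  interpret M: prob_space M by fact
  interpret N: prob_space N by fact
  define f where "f = (\<lambda>w. \<integral>x. max (X x - w) 0 \<partial>M)"
  define g where "g = (\<lambda>w. \<integral>y. max (Y y - w) 0 \<partial>N)"
  have f: "0 \<le> f w" for w unfolding f_def by (intro integral_nonneg_AE) auto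
  have g: "(\<integral>y. Y y \<partial>N) - w \<le> g w" for w
    using N.CVaR_objective_ge[OF Y, of 1 w] by (simp add: g_def)
  let ?c = "(\<alpha> + \<epsilon> - 1) * a + (\<integral>y. Y y \<partial>N)"
  have key_ge: "?c \<le> \<alpha> * w + f w + (\<epsilon> * v + g v)" if w: "a \<le> w" for w v
  proof -
    have aw: "(\<alpha> + \<epsilon> - 1) * a \<le> (\<alpha> + \<epsilon> - 1) * w" using w \<epsilon> by (intro mult_left_mono) auto
    show ?thesis
    proof (cases "w \<le> v")
      case True
      then have "g w \<le> f w + g v + \<epsilon> * (v - w)"
        using clamp[OF True] f[of v] unfolding f_def g_def by linarith
      then show ?thesis using g[of w] aw by (simp add: algebra_simps)
    next
      case False
      then have "(1 - \<epsilon>) * v \<le> (1 - \<epsilon>) * w" using \<epsilon> by (intro mult_left_mono) auto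
      then show ?thesis using g[of v] f[of w] aw by (simp add: algebra_simps)
    qed
  qed
  have key: "?c \<le> \<alpha> * w + f w + (\<epsilon> * v + g v)" for w v
  proof (cases "a \<le> w")
    case False
    \<comment> \<open>Below \<open>a\<close> the expected excess has slope -1. As \<alpha> \<le> 1,
      raising \<open>w\<close> to \<open>a\<close> does not increase \<alpha> w + f w, so the case w
      < a reduces to w = a.\<close>
    have "f u = (\<integral>x. X x \<partial>M) - u" if "u \<le> a" for u
    proof -
      have "f u = (\<integral>x. X x - u \<partial>M)"
        unfolding f_def using a that X by (intro integral_cong_AE) (auto simp: max_def)
      then show ?thesis using X by (simp add: M.prob_space)
    qed
    then have "f w = f a + (a - w)" using False by simp
    moreover have "\<alpha> * (a - w) \<le> 1 * (a - w)" using False \<alpha> by (intro mult_right_mono) auto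
    ultimately show ?thesis using key_ge[of a v] by (simp add: algebra_simps)
  qed (rule key_ge)
  have "(?c - \<epsilon> * CVaR N \<epsilon> Y) / \<alpha> \<le> CVaR M \<alpha> X"
  proof (rule CVaR_ge_scaled)
    fix w
    have "(?c - (\<alpha> * w + f w)) / \<epsilon> \<le> CVaR N \<epsilon> Y"
      by (rule CVaR_ge_scaled) (use key[of w] \<epsilon> in \<open>simp_all add: g_def algebra_simps\<close>)
    then show "?c - \<epsilon> * CVaR N \<epsilon> Y \<le> \<alpha> * w + (\<integral>x. max (X x - w) 0 \<partial>M)"
      using \<epsilon> by (simp add: f_def field_simps)
  qed (use \<alpha> in simp)
  then show ?thesis by simp
qed

section \<open>Measurability of the sample CVaR, and the probability bounds\<close>

lemma borel_measurable_emp_CVaR: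
  fixes Xs :: "nat \<Rightarrow> 'a \<Rightarrow> real"
  assumes n: "n \<ge> 1" and \<beta>: "0 < \<beta>" "\<beta> \<le> 1"
    and [measurable]: "\<And>i. i \<in> {1..n} \<Longrightarrow> Xs i \<in> borel_measurable M"
  shows "(\<lambda>\<omega>. emp_CVaR n (\<lambda>i. Xs i \<omega>) \<beta>) \<in> borel_measurable M"
proof -
  let ?f = "\<lambda>x w. w + 1 / (real n * \<beta>) * (\<Sum>i=1..n. max (x i - w) 0)"
  \<comment> \<open>The sample mean is a lower bound, with the sample read as a variable on
    uniformly drawn indices; this is where \<beta> \<le> 1 enters.\<close>
  have "bdd_below (range (?f x))" for x :: "nat \<Rightarrow> real"
  proof (rule bdd_belowI2)
    let ?U = "measure_pmf (pmf_of_set {1..n})"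
    have "integrable ?U x" using n by (intro integrable_measure_pmf_finite) simp
    from measure_pmf.CVaR_objective_ge[OF this \<beta>]
    show "(\<integral>i. x i \<partial>?U) \<le> ?f x w" for w
      using n by (simp add: integral_pmf_of_set mult.commute)
  qed
  then have INF: "emp_CVaR n x \<beta> = (INF w\<in>\<rat>. ?f x w)" for x
    unfolding emp_CVaR_def by (intro INF_real_eq_INF_Rats continuous_intros)
  show ?thesis
    unfolding INF by (intro borel_measurable_cINF_real countable_rat) measurable
qed

text \<open>The condition \<epsilon> \<le> 1 in the last bound keeps the sample CVaR at level
  \<epsilon> meaningful: for larger \<epsilon> its objective is unbounded below
  (\<open>emp_CVaR_objective_unbounded\<close>) and the real-valued \<open>INF\<close> is not the
  infimum.\<close>

theorem theorem5p5:
  fixes M :: "'a measure" and X :: "'a \<Rightarrow> real" and Xs :: "nat \<Rightarrow> 'a \<Rightarrow> real"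
    and n :: nat and \<alpha> \<delta> \<epsilon> a b :: real
  assumes "prob_space M"
    and "integrable M X"
    and "n \<ge> 1"
    and "0 < \<alpha>" "\<alpha> \<le> 1"
    and "0 < \<delta>" "\<delta> < 1 / 2"
    and "\<epsilon> = sqrt (ln (1 / \<delta>) / (2 * real n))"
    and "prob_space.indep_vars M (\<lambda>_. borel) Xs {1..n}"
    and "\<And>i. i \<in> {1..n} \<Longrightarrow> cdf (distr M borel (Xs i)) = cdf (distr M borel X)"
  shows
    "(\<P>(\<omega> in M. X \<omega> \<le> b) = 1 \<longrightarrow>
        (\<alpha> > \<epsilon> \<longrightarrow>
          \<P>(\<omega> in M. CVaR M \<alpha> X \<le>
            (1 - \<epsilon> / \<alpha>) * emp_CVaR n (\<lambda>i. Xs i \<omega>) (\<alpha> - \<epsilon>) + \<epsilon> / \<alpha> * b) > 1 - \<delta>) \<and>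
        (\<alpha> \<le> \<epsilon> \<longrightarrow> CVaR M \<alpha> X \<le> b)) \<and>
     (\<P>(\<omega> in M. X \<omega> \<ge> a) = 1 \<longrightarrow>
        (\<alpha> + \<epsilon> < 1 \<longrightarrow>
          \<P>(\<omega> in M. CVaR M \<alpha> X \<ge>
            (1 + \<epsilon> / \<alpha>) * emp_CVaR n (\<lambda>i. Xs i \<omega>) (\<alpha> + \<epsilon>)
              - \<epsilon> / \<alpha> * emp_CVaR n (\<lambda>i. Xs i \<omega>) \<epsilon>) > 1 - \<delta>) \<and>
        (\<alpha> + \<epsilon> \<ge> 1 \<and> \<epsilon> \<le> 1 \<longrightarrow>
          \<P>(\<omega> in M. CVaR M \<alpha> X \<ge>
            1 / \<alpha> * ((\<alpha> + \<epsilon> - 1) * a + emp_mean n (\<lambda>i. Xs i \<omega>)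
              - \<epsilon> * emp_CVaR n (\<lambda>i. Xs i \<omega>) \<epsilon>)) > 1 - \<delta>))"
proof -
  interpret prob_space M by fact
  note X = \<open>integrable M X\<close> and n = \<open>n \<ge> 1\<close> and \<alpha> = \<open>0 < \<alpha>\<close> \<open>\<alpha> \<le> 1\<close>
    and \<delta> = \<open>0 < \<delta>\<close> \<open>\<delta> < 1 / 2\<close> and indep = \<open>indep_vars (\<lambda>_. borel) Xs {1..n}\<close>
  have X_meas[measurable]: "X \<in> borel_measurable M" using X by auto
  have Xs[measurable]: "Xs i \<in> borel_measurable M" if "i \<in> {1..n}" for i
    using indep that by (auto simp: indep_vars_def)
  have distr: "distr M borel (Xs i) = distr M borel X" if i: "i \<in> {1..n}" for i
    using assms(10)[OF i] Xs[OF i]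
    by (intro cdf_unique real_distribution_distr) simp_all
  have ln_pos: "ln (1 / \<delta>) > 0" using \<delta> by (intro ln_gt_zero) simp
  then have \<epsilon>: "\<epsilon> > 0" using n assms(8) by simp
  have "\<epsilon>^2 = ln (1 / \<delta>) / (2 * real n)"
    unfolding assms(8) using ln_pos by (intro real_sqrt_pow2 divide_nonneg_nonneg) auto
  then have \<epsilon>2: "exp (- 2 * real n * \<epsilon>^2) = \<delta>"
    using n \<delta> by (simp add: ln_div)
  \<comment> \<open>On a uniformly drawn index the map \<open>\<lambda>i. Xs i \<omega>\<close> is a
    random variable with the empirical law. For each fixed \<omega> the comparison lemmas then apply
    with \<open>U\<close> as the second measure.\<close>
  define U where "U = measure_pmf (pmf_of_set {1..n})"
  interpret U: prob_space U unfolding U_def by (rule measure_pmf.prob_space_axioms)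
  have ne: "{1..n} \<noteq> {}" "finite {1..n}" using n by auto
  have U_int: "integrable U x" for x :: "nat \<Rightarrow> real"
    unfolding U_def using ne by (intro integrable_measure_pmf_finite) simp
  have U_tail: "\<P>(i in U. P i) = 1 / real n * real (card {i\<in>{1..n}. P i})" for P
    unfolding U_def using ne by (simp add: measure_pmf_of_set Int_def)
  have U_mean: "emp_mean n x = (\<integral>i. x i \<partial>U)" for x
    unfolding U_def emp_mean_def using ne by (simp add: integral_pmf_of_set)
  have U_CVaR: "emp_CVaR n x \<beta> = CVaR U \<beta> x" for x \<beta>
    unfolding U_def emp_CVaR_def CVaR_def using ne by (simp add: integral_pmf_of_set mult.commute)
  note CVaR_meas[measurable] = borel_measurable_emp_CVaR[OF n _ _ Xs]
  have mean_meas[measurable]: "(\<lambda>\<omega>. emp_mean n (\<lambda>i. Xs i \<omega>)) \<in> borel_measurable M"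
    unfolding emp_mean_def by measurable
  obtain E\<^sub>1 where E\<^sub>1: "E\<^sub>1 \<in> events" "prob E\<^sub>1 > 1 - \<delta>"
    and tail\<^sub>1: "\<And>\<omega> u. \<omega> \<in> E\<^sub>1 \<Longrightarrow> \<P>(i in U. u < Xs i \<omega>) \<le> \<P>(\<omega> in M. u < X \<omega>) + \<epsilon>"
    using one_sided_DKW_strict[OF n \<epsilon> X_meas indep distr] unfolding \<epsilon>2 U_tail by blast
  have lower: "(\<integral>i. max (Xs i \<omega> - w) 0 \<partial>U) - (\<integral>i. max (Xs i \<omega> - v) 0 \<partial>U) \<le>
      (\<integral>\<omega>. max (X \<omega> - w) 0 \<partial>M) - (\<integral>\<omega>. max (X \<omega> - v) 0 \<partial>M) + \<epsilon> * (v - w)"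
    if "\<omega> \<in> E\<^sub>1" "w \<le> v" for \<omega> w v
    using \<epsilon> by (intro expectation_clamp_le prob_space_axioms U.prob_space_axioms X U_int that tail\<^sub>1) auto
  \<comment> \<open>The upper bound needs the empirical tail not to fall too far below the true one,
    which is the upper tail deviation of the negated sample.\<close>
  have indep': "indep_vars (\<lambda>_. borel) (\<lambda>i \<omega>. - Xs i \<omega>) {1..n}"
    using indep_vars_compose2[OF indep, of "\<lambda>_. uminus" "\<lambda>_. borel"] by simp
  have distr': "distr M borel (\<lambda>\<omega>. - Xs i \<omega>) = distr M borel (\<lambda>\<omega>. - X \<omega>)" if i: "i \<in> {1..n}" for i
    using arg_cong[OF distr[OF i], of "\<lambda>N. distr N borel uminus"] Xs[OF i]
    by (simp add: distr_distr comp_def)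
  have X_meas': "(\<lambda>\<omega>. - X \<omega>) \<in> borel_measurable M" by simp
  obtain E\<^sub>2 where E\<^sub>2: "E\<^sub>2 \<in> events" "prob E\<^sub>2 > 1 - \<delta>"
    and tail\<^sub>2: "\<And>\<omega> u. \<omega> \<in> E\<^sub>2 \<Longrightarrow> \<P>(i in U. u < - Xs i \<omega>) \<le> \<P>(\<omega> in M. u < - X \<omega>) + \<epsilon>"
    using one_sided_DKW_strict[OF n \<epsilon> X_meas' indep' distr'] unfolding \<epsilon>2 U_tail by blast
  have upper: "(\<integral>\<omega>. max (X \<omega> - w) 0 \<partial>M) - (\<integral>\<omega>. max (X \<omega> - v) 0 \<partial>M) \<le>
      (\<integral>i. max (Xs i \<omega> - w) 0 \<partial>U) - (\<integral>i. max (Xs i \<omega> - v) 0 \<partial>U) + \<epsilon> * (v - w)"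
    if "\<omega> \<in> E\<^sub>2" "w \<le> v" for \<omega> w v
  proof -
    \<comment> \<open>From (u - Z)^+ = (Z - u)^+ + u - Z. The means cancel in differences, so the
      clamp bound for \<open>- X\<close> on [-v, -w] becomes the one for \<open>X\<close> on [w, v]
      with the two laws exchanged.\<close>
    have reflect: "(\<integral>x. max (- Z x - - u) 0 \<partial>N) = (\<integral>x. max (Z x - u) 0 \<partial>N) + u - (\<integral>x. Z x \<partial>N)"
      if N: "prob_space N" "integrable N Z" for N :: "'c measure" and Z :: "'c \<Rightarrow> real" and u
    proof -
      interpret N: prob_space N by fact
      have "(\<integral>x. max (- Z x - - u) 0 \<partial>N) = (\<integral>x. max (Z x - u) 0 + u - Z x \<partial>N)"
        by (intro Bochner_Integration.integral_cong) (auto simp: max_def)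
      also have "\<dots> = (\<integral>x. max (Z x - u) 0 \<partial>N) + u - (\<integral>x. Z x \<partial>N)"
        using N(2) by (simp add: N.prob_space)
      finally show ?thesis .
    qed
    have "(\<integral>i. max (- Xs i \<omega> - - v) 0 \<partial>U) - (\<integral>i. max (- Xs i \<omega> - - w) 0 \<partial>U) \<le>
        (\<integral>\<omega>. max (- X \<omega> - - v) 0 \<partial>M) - (\<integral>\<omega>. max (- X \<omega> - - w) 0 \<partial>M) + \<epsilon> * (- w - - v)"
      using \<epsilon> X that
      by (intro expectation_clamp_le prob_space_axioms U.prob_space_axioms U_int tail\<^sub>2) auto
    then show ?thesis
      unfolding reflect[OF prob_space_axioms X] reflect[OF U.prob_space_axioms U_int] by simp
  qed
  show ?thesis
  proof (intro conjI impI)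
    assume "\<P>(\<omega> in M. X \<omega> \<le> b) = 1"
    then have b: "AE \<omega> in M. X \<omega> \<le> b" by (subst (asm) prob_Collect_eq_1) auto
    then show "CVaR M \<alpha> X \<le> b" by (intro CVaR_le_AE_bound prob_space_axioms X \<alpha>)
    assume "\<epsilon> < \<alpha>"
    \<comment> \<open>Measurability matters for the target event: \<open>measure\<close> is 0 on
      sets outside the sigma-algebra, so the inclusion of \<open>E\<^sub>2\<close> alone would not
      bound its probability.\<close>
    then have [measurable]: "(\<lambda>\<omega>. emp_CVaR n (\<lambda>i. Xs i \<omega>) (\<alpha> - \<epsilon>)) \<in> borel_measurable M"
      using \<alpha> \<epsilon> by (intro CVaR_meas) auto
    let ?G = "{\<omega> \<in> space M. CVaR M \<alpha> X \<le>
      (1 - \<epsilon> / \<alpha>) * emp_CVaR n (\<lambda>i. Xs i \<omega>) (\<alpha> - \<epsilon>) + \<epsilon> / \<alpha> * b}"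
    have "\<omega> \<in> ?G" if "\<omega> \<in> E\<^sub>2" for \<omega>
      using sets.sets_into_space[OF E\<^sub>2(1)] that
        CVaR_upper_bound[OF prob_space_axioms U.prob_space_axioms X U_int \<alpha>(2) \<epsilon> \<open>\<epsilon> < \<alpha>\<close> b upper[OF that]]
      by (auto simp: U_CVaR)
    then have "E\<^sub>2 \<subseteq> ?G" by blast
    then have "prob E\<^sub>2 \<le> prob ?G" by (intro finite_measure_mono) measurable
    with E\<^sub>2(2) show "prob ?G > 1 - \<delta>" by linarith
  next
    assume "\<alpha> + \<epsilon> < 1"
    then have [measurable]: "(\<lambda>\<omega>. emp_CVaR n (\<lambda>i. Xs i \<omega>) (\<alpha> + \<epsilon>)) \<in> borel_measurable M"
      "(\<lambda>\<omega>. emp_CVaR n (\<lambda>i. Xs i \<omega>) \<epsilon>) \<in> borel_measurable M"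
      using \<alpha> \<epsilon> by (auto intro!: CVaR_meas)
    let ?G = "{\<omega> \<in> space M. CVaR M \<alpha> X \<ge> (1 + \<epsilon> / \<alpha>) * emp_CVaR n (\<lambda>i. Xs i \<omega>) (\<alpha> + \<epsilon>)
      - \<epsilon> / \<alpha> * emp_CVaR n (\<lambda>i. Xs i \<omega>) \<epsilon>}"
    have "\<omega> \<in> ?G" if "\<omega> \<in> E\<^sub>1" for \<omega>
      using sets.sets_into_space[OF E\<^sub>1(1)] that \<open>\<alpha> + \<epsilon> < 1\<close>
        CVaR_lower_bound[OF prob_space_axioms U.prob_space_axioms X U_int \<alpha>(1) \<epsilon> _ lower[OF that]]
      by (auto simp: U_CVaR)
    then have "E\<^sub>1 \<subseteq> ?G" by blast
    then have "prob E\<^sub>1 \<le> prob ?G" by (intro finite_measure_mono) measurable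
    with E\<^sub>1(2) show "prob ?G > 1 - \<delta>" by linarith
  next
    assume "\<P>(\<omega> in M. X \<omega> \<ge> a) = 1"
    then have a: "AE \<omega> in M. a \<le> X \<omega>" by (subst (asm) prob_Collect_eq_1) auto
    assume e1: "\<alpha> + \<epsilon> \<ge> 1 \<and> \<epsilon> \<le> 1"
    then have [measurable]: "(\<lambda>\<omega>. emp_CVaR n (\<lambda>i. Xs i \<omega>) \<epsilon>) \<in> borel_measurable M"
      using \<epsilon> by (intro CVaR_meas) auto
    let ?G = "{\<omega> \<in> space M. CVaR M \<alpha> X \<ge> 1 / \<alpha> * ((\<alpha> + \<epsilon> - 1) * a + emp_mean n (\<lambda>i. Xs i \<omega>)
      - \<epsilon> * emp_CVaR n (\<lambda>i. Xs i \<omega>) \<epsilon>)}"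
    have "\<omega> \<in> ?G" if "\<omega> \<in> E\<^sub>1" for \<omega>
      using sets.sets_into_space[OF E\<^sub>1(1)] that e1 \<alpha> \<epsilon>
        CVaR_lower_bound_AE[OF prob_space_axioms U.prob_space_axioms X U_int \<alpha> \<epsilon> _ _ a lower[OF that]]
      by (auto simp: U_CVaR U_mean)
    then have "E\<^sub>1 \<subseteq> ?G" by blast
    then have "prob E\<^sub>1 \<le> prob ?G" by (intro finite_measure_mono) measurable
    with E\<^sub>1(2) show "prob ?G > 1 - \<delta>" by linarith
  qed
qed

end
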